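(* If a compact space $K$ has the Grothendieck property, then $K$ does not have the finitely supported Josefson--Nissenzweig property.
   Context: All compact spaces are Hausdorff. A measure on $K$ is a signed $\sigma$-additive Radon measure on the Borel $\sigma$-algebra of $K$, with total variation norm $\|\cdot\|$. A sequence of measures $\mu_n$ on $K$ is weakly* convergent to $\mu$ if $\int_K f\,d\mu_n\to\int_K f\,d\mu$ for every $f\in C(K)$, and weakly convergent to $\mu$ if $\mu_n(B)\to\mu(B)$ for every Borel $B\subseteq K$. $K$ has the Grothendieck property if every weakly* convergent sequence of measures on $K$ is weakly convergent (equivalently, $C(K)$ is a Grothendieck Banach space). $K$ has the finitely supported Josefson--Nissenzweig property (fsJNP) if there is a sequence $\langle\mu_n\colon n\in\omega\rangle$ of finitely supported measures on $K$ with $\|\mu_n\|=1$ for all $n$ which is weakly* convergent to the zero measure. *)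

theory Defs
  imports "HOL-Analysis.Analysis"
begin

definition borel_of :: "'a topology \<Rightarrow> 'a measure" where
  "borel_of K = sigma (topspace K) {U. openin K U}"

lemma space_borel_of [simp]: "space (borel_of K) = topspace K"
  unfolding borel_of_def by (rule space_measure_of) (auto dest: openin_subset)

text \<open>
  A finite signed measure on \<open>K\<close> is represented by a real-valued set function, of which only
  the values on Borel sets matter.
\<close>

definition signed_measure :: "'a topology \<Rightarrow> ('a set \<Rightarrow> real) \<Rightarrow> bool" where
  "signed_measure K \<mu> \<longleftrightarrow> \<mu> {} = 0 \<and>
     (\<forall>A :: nat \<Rightarrow> 'a set. range A \<subseteq> sets (borel_of K) \<longrightarrow> disjoint_family A \<longrightarrow>
        (\<lambda>i. \<mu> (A i)) sums \<mu> (\<Union>i. A i))"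

definition variation :: "'a topology \<Rightarrow> ('a set \<Rightarrow> real) \<Rightarrow> 'a set \<Rightarrow> ennreal" where
  "variation K \<mu> B =
     (SUP P \<in> {P. finite P \<and> disjoint P \<and> P \<subseteq> sets (borel_of K) \<and> \<Union>P = B}.
        \<Sum>E\<in>P. ennreal \<bar>\<mu> E\<bar>)"

definition total_variation_norm :: "'a topology \<Rightarrow> ('a set \<Rightarrow> real) \<Rightarrow> ennreal" where
  "total_variation_norm K \<mu> = variation K \<mu> (topspace K)"

definition radon_measure :: "'a topology \<Rightarrow> ('a set \<Rightarrow> real) \<Rightarrow> bool" where
  "radon_measure K \<mu> \<longleftrightarrow> signed_measure K \<mu> \<and>
     (\<forall>B \<in> sets (borel_of K). \<forall>e>0.
        \<exists>C. compactin K C \<and> C \<subseteq> B \<and> variation K \<mu> (B - C) < ennreal e)"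

text \<open>
  Jordan decomposition: the positive part of \<open>\<mu>\<close> assigns to a Borel set \<open>B\<close> the supremum of
  \<open>\<mu> E\<close> over Borel \<open>E \<subseteq> B\<close>. Negative values are truncated to \<open>0\<close> by \<open>ennreal\<close>, which does not
  affect the supremum, as \<open>E = {}\<close> is allowed. The negative part is the positive part of \<open>- \<mu>\<close>.
\<close>

definition positive_variation :: "'a topology \<Rightarrow> ('a set \<Rightarrow> real) \<Rightarrow> 'a set \<Rightarrow> ennreal" where
  "positive_variation K \<mu> B = (SUP E \<in> {E \<in> sets (borel_of K). E \<subseteq> B}. ennreal (\<mu> E))"

definition positive_part :: "'a topology \<Rightarrow> ('a set \<Rightarrow> real) \<Rightarrow> 'a measure" where
  "positive_part K \<mu> = measure_of (topspace K) (sets (borel_of K)) (positive_variation K \<mu>)"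

definition signed_integral :: "'a topology \<Rightarrow> ('a set \<Rightarrow> real) \<Rightarrow> ('a \<Rightarrow> real) \<Rightarrow> real" where
  "signed_integral K \<mu> f =
     (LINT x|positive_part K \<mu>. f x) - (LINT x|positive_part K (\<lambda>E. - \<mu> E). f x)"

definition weakly_star_convergent ::
    "'a topology \<Rightarrow> (nat \<Rightarrow> 'a set \<Rightarrow> real) \<Rightarrow> ('a set \<Rightarrow> real) \<Rightarrow> bool" where
  "weakly_star_convergent K \<mu> \<nu> \<longleftrightarrow>
     (\<forall>f. continuous_map K euclideanreal f \<longrightarrow>
        (\<lambda>n. signed_integral K (\<mu> n) f) \<longlonglongrightarrow> signed_integral K \<nu> f)"

definition weakly_convergent ::
    "'a topology \<Rightarrow> (nat \<Rightarrow> 'a set \<Rightarrow> real) \<Rightarrow> ('a set \<Rightarrow> real) \<Rightarrow> bool" where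
  "weakly_convergent K \<mu> \<nu> \<longleftrightarrow> (\<forall>B \<in> sets (borel_of K). (\<lambda>n. \<mu> n B) \<longlonglongrightarrow> \<nu> B)"

definition grothendieck_property :: "'a topology \<Rightarrow> bool" where
  "grothendieck_property K \<longleftrightarrow>
     (\<forall>\<mu> \<nu>. (\<forall>n. radon_measure K (\<mu> n)) \<longrightarrow> radon_measure K \<nu> \<longrightarrow>
        weakly_star_convergent K \<mu> \<nu> \<longrightarrow> weakly_convergent K \<mu> \<nu>)"

definition measure_support :: "'a topology \<Rightarrow> ('a set \<Rightarrow> real) \<Rightarrow> 'a set" where
  "measure_support K \<mu> =
     {x \<in> topspace K. \<forall>U. openin K U \<longrightarrow> x \<in> U \<longrightarrow> variation K \<mu> U > 0}"

definition fsJNP :: "'a topology \<Rightarrow> bool" where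
  "fsJNP K \<longleftrightarrow>
     (\<exists>\<mu> :: nat \<Rightarrow> 'a set \<Rightarrow> real.
        (\<forall>n. radon_measure K (\<mu> n) \<and> finite (measure_support K (\<mu> n)) \<and>
             total_variation_norm K (\<mu> n) = 1) \<and>
        weakly_star_convergent K \<mu> (\<lambda>_. 0))"

text \<open>
  \<^const>\<open>measure_of\<close> yields the zero measure unless its argument is countably additive; the
  following shows that this does not happen in \<^const>\<open>positive_part\<close>.
\<close>

lemma signed_measure_Un:
  assumes "signed_measure K \<mu>" "A \<in> sets (borel_of K)" "B \<in> sets (borel_of K)" "A \<inter> B = {}"
  shows "\<mu> (A \<union> B) = \<mu> A + \<mu> B"
proof -
  have "range (binaryset A B) \<subseteq> sets (borel_of K)" "disjoint_family (binaryset A B)"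
    using assms by (auto simp: range_binaryset_eq disjoint_family_on_def binaryset_def)
  then have "(\<lambda>i. \<mu> (binaryset A B i)) sums \<mu> (A \<union> B)"
    using assms(1) unfolding signed_measure_def by (metis UN_binaryset_eq)
  moreover have "(\<lambda>i. \<mu> (binaryset A B i)) sums (\<mu> A + \<mu> B)"
    using assms(1) by (intro binaryset_sums) (simp add: signed_measure_def)
  ultimately show ?thesis by (rule sums_unique2)
qed

lemma positive_variation_Un:
  assumes "signed_measure K \<mu>" "A \<in> sets (borel_of K)" "B \<in> sets (borel_of K)" "A \<inter> B = {}"
  shows "positive_variation K \<mu> A + positive_variation K \<mu> B \<le> positive_variation K \<mu> (A \<union> B)"
proof -
  let ?S = "\<lambda>B. {E \<in> sets (borel_of K). E \<subseteq> B}"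
  have "ennreal (\<mu> E) + ennreal (\<mu> F) \<le> positive_variation K \<mu> (A \<union> B)"
    if EF: "E \<in> ?S A" "F \<in> ?S B" for E F
  proof -
    define G where "G = (if \<mu> E < 0 then {} else E)"
    define H where "H = (if \<mu> F < 0 then {} else F)"
    have 0: "\<mu> {} = 0" using assms(1) by (simp add: signed_measure_def)
    have GH: "G \<in> sets (borel_of K)" "H \<in> sets (borel_of K)" "G \<subseteq> A" "H \<subseteq> B"
      using EF by (auto simp: G_def H_def)
    have "ennreal (\<mu> E) + ennreal (\<mu> F) = ennreal (\<mu> G + \<mu> H)"
      by (auto simp: G_def H_def 0 ennreal_neg ennreal_plus)
    also have "\<mu> G + \<mu> H = \<mu> (G \<union> H)"
      using GH assms by (intro signed_measure_Un[symmetric, where K = K]) auto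
    also have "ennreal \<dots> \<le> positive_variation K \<mu> (A \<union> B)"
      unfolding positive_variation_def using GH by (intro SUP_upper) auto
    finally show ?thesis .
  qed
  then have "(SUP E \<in> ?S A. SUP F \<in> ?S B. ennreal (\<mu> E) + ennreal (\<mu> F))
      \<le> positive_variation K \<mu> (A \<union> B)"
    by (intro SUP_least) blast
  moreover have "?S A \<noteq> {}" "?S B \<noteq> {}" by auto
  ultimately show ?thesis
    by (simp add: positive_variation_def flip: ennreal_SUP_add_left ennreal_SUP_add_right)
qed

lemma emeasure_positive_part:
  assumes "signed_measure K \<mu>" "B \<in> sets (borel_of K)"
  shows "emeasure (positive_part K \<mu>) B = positive_variation K \<mu> B"
proof (rule emeasure_measure_of[OF positive_part_def])
  let ?S = "sets (borel_of K)" and ?p = "positive_variation K \<mu>"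
  show "?S \<subseteq> Pow (topspace K)"
    using sets.sets_into_space[of _ "borel_of K"] by auto
  have "{E \<in> ?S. E \<subseteq> {}} = {{}}" by auto
  then have p0: "?p {} = 0"
    using assms(1) by (simp add: positive_variation_def signed_measure_def)
  have sets_pp: "sets (positive_part K \<mu>) = ?S"
    unfolding positive_part_def using sets.sigma_sets_eq[of "borel_of K"]
      sets.sets_into_space[of _ "borel_of K"] by (subst sets_measure_of) auto
  show "B \<in> sets (positive_part K \<mu>)" using assms(2) sets_pp by simp
  show "positive (sets (positive_part K \<mu>)) ?p"
    by (simp add: positive_def p0)
  show "countably_additive (sets (positive_part K \<mu>)) ?p"
    unfolding countably_additive_def sets_pp
  proof (intro allI impI antisym)
    fix A :: "nat \<Rightarrow> 'a set"
    assume A: "range A \<subseteq> ?S" "disjoint_family A" "(\<Union>i. A i) \<in> ?S"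
    have fin: "(\<Sum>i<n. ?p (A i)) \<le> ?p (\<Union>i<n. A i)" for n
    proof (induction n)
      case (Suc n)
      have "(\<Sum>i<Suc n. ?p (A i)) \<le> ?p (\<Union>i<n. A i) + ?p (A n)"
        using Suc by (simp add: add_right_mono)
      also have "\<dots> \<le> ?p ((\<Union>i<n. A i) \<union> A n)"
        using A by (intro positive_variation_Un assms(1))
          (auto simp: disjoint_family_on_def, metis Int_iff empty_iff less_irrefl)
      also have "(\<Union>i<n. A i) \<union> A n = (\<Union>i<Suc n. A i)"
        by (auto simp: less_Suc_eq)
      finally show ?case .
    qed (simp add: p0)
    have mono: "?p (\<Union>i<n. A i) \<le> ?p (\<Union>i. A i)" for n
      unfolding positive_variation_def by (rule SUP_subset_mono) auto
    show "(\<Sum>i. ?p (A i)) \<le> ?p (\<Union>i. A i)"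
      by (intro suminf_le_const summableI) (metis fin mono order_trans)
    show "?p (\<Union>i. A i) \<le> (\<Sum>i. ?p (A i))"
      unfolding positive_variation_def[of K \<mu> "\<Union>i. A i"]
    proof (rule SUP_least)
      fix E assume "E \<in> {E \<in> ?S. E \<subseteq> (\<Union>i. A i)}"
      then have E: "E \<in> ?S" "E \<subseteq> (\<Union>i. A i)" by auto
      have "range (\<lambda>i. E \<inter> A i) \<subseteq> ?S" "disjoint_family (\<lambda>i. E \<inter> A i)"
        using A E by (auto simp: disjoint_family_on_def)
      moreover have "(\<Union>i. E \<inter> A i) = E" using E by auto
      ultimately have "(\<lambda>i. \<mu> (E \<inter> A i)) sums \<mu> E"
        using assms(1) unfolding signed_measure_def by metis
      then have "(\<lambda>n. ennreal (\<Sum>i<n. \<mu> (E \<inter> A i))) \<longlonglongrightarrow> ennreal (\<mu> E)"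
        unfolding sums_def by (rule tendsto_ennrealI)
      moreover have "ennreal (\<Sum>i<n. \<mu> (E \<inter> A i)) \<le> (\<Sum>i. ?p (A i))" for n
      proof -
        have "ennreal (\<Sum>i<n. \<mu> (E \<inter> A i)) \<le> ennreal (\<Sum>i<n. max 0 (\<mu> (E \<inter> A i)))"
          by (intro ennreal_leI sum_mono) simp
        also have "\<dots> = (\<Sum>i<n. ennreal (max 0 (\<mu> (E \<inter> A i))))"
          by (simp add: sum_ennreal)
        also have "\<dots> \<le> (\<Sum>i<n. ?p (A i))"
          unfolding positive_variation_def ennreal_max_0 using A E
          by (intro sum_mono SUP_upper) auto
        also have "\<dots> \<le> (\<Sum>i. ?p (A i))"
          by (intro sum_le_suminf summableI) auto
        finally show ?thesis .
      qed
      ultimately show "ennreal (\<mu> E) \<le> (\<Sum>i. ?p (A i))"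
        by (intro LIMSEQ_le_const2) auto
    qed
  qed
qed

end

theory Submission
  imports Defs
begin

text \<open>
  Suppose that finitely supported measures \<open>\<mu>\<^sub>n\<close> of norm \<open>1\<close> converge weakly* to zero. By the
  Grothendieck property, \<open>\<mu>\<^sub>n(B) \<rightarrow> 0\<close> for every Borel set \<open>B\<close>. The union \<open>S\<close> of the supports is
  countable and points are closed, so \<^emph>\<open>every\<close> subset of \<open>S\<close> is Borel. A finitely supported Radon
  measure is the sum of its point masses (\<open>radon_measure_eq_sum_point_masses\<close>), hence the \<open>\<mu>\<^sub>n\<close> are
  unit vectors of \<open>\<ell>\<^sub>1(S)\<close> whose sums over each subset of \<open>S\<close> tend to zero. This contradicts the
  Schur property of \<open>\<ell>\<^sub>1\<close>, which for finitely supported vectors is a short gliding hump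
  argument (\<open>gliding_hump\<close>).
\<close>

section \<open>The Schur property for finitely supported vectors\<close>

text \<open>
  One of the two sets on which \<open>a\<close> has constant sign carries at least half of the mass.
\<close>

lemma ex_subset_half_abs_sum:
  fixes a :: "'a \<Rightarrow> real"
  assumes "finite A"
  shows "\<exists>P\<subseteq>A. (\<Sum>x\<in>A. \<bar>a x\<bar>) \<le> 2 * \<bar>\<Sum>x\<in>P. a x\<bar>"
proof -
  let ?P = "{x\<in>A. a x \<ge> 0}" and ?N = "{x\<in>A. a x < 0}"
  have A: "A = ?P \<union> ?N" by auto
  have "(\<Sum>x\<in>A. \<bar>a x\<bar>) = (\<Sum>x\<in>?P. \<bar>a x\<bar>) + (\<Sum>x\<in>?N. \<bar>a x\<bar>)"
    using assms by (subst A, intro sum.union_disjoint) auto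
  also have "(\<Sum>x\<in>?P. \<bar>a x\<bar>) = (\<Sum>x\<in>?P. a x)"
    by (intro sum.cong) auto
  also have "(\<Sum>x\<in>?N. \<bar>a x\<bar>) = - (\<Sum>x\<in>?N. a x)"
    unfolding sum_negf[symmetric] by (intro sum.cong) auto
  finally have "(\<Sum>x\<in>A. \<bar>a x\<bar>) \<le> 2 * \<bar>\<Sum>x\<in>?P. a x\<bar> \<or> (\<Sum>x\<in>A. \<bar>a x\<bar>) \<le> 2 * \<bar>\<Sum>x\<in>?N. a x\<bar>"
    by linarith
  moreover have "?P \<subseteq> A" "?N \<subseteq> A" by auto
  ultimately show ?thesis by blast
qed

text \<open>
  The Schur property of \<open>\<ell>\<^sub>1\<close> for finitely supported vectors. If singletons do not already serve as
  \<open>B\<close>, then the vectors tend to zero at every point, so along a subsequence each vector has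
  little mass on the union \<open>G\<close> of all earlier supports. On the rest of its support one
  chooses a part \<open>P\<close> that carries half of its mass with a constant sign, and \<open>B\<close> is the union
  of these humps. Later humps avoid the earlier supports, so the sum of a vector over \<open>B\<close>
  differs from the sum over its own hump only by terms in \<open>G\<close>.
\<close>

lemma gliding_hump:
  fixes a :: "nat \<Rightarrow> 'a \<Rightarrow> real"
  assumes fin: "\<And>n. finite (F n)" and "e > 0" and mass: "\<And>n. (\<Sum>x\<in>F n. \<bar>a n x\<bar>) \<ge> e"
  shows "\<exists>B \<subseteq> (\<Union>n. F n). \<not> (\<lambda>n. \<Sum>x\<in>B \<inter> F n. a n x) \<longlonglongrightarrow> 0"
proof (rule ccontr)
  assume contra: "\<not> ?thesis"
  then have null: "(\<lambda>n. \<Sum>x\<in>B \<inter> F n. a n x) \<longlonglongrightarrow> 0" if "B \<subseteq> (\<Union>n. F n)" for B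
    using that by blast
  define G where "G N = (\<Union>m\<le>N. F m)" for N
  have finG: "finite (G N)" for N
    unfolding G_def using fin by blast
  have G_null: "(\<lambda>n. \<Sum>x\<in>G N \<inter> F n. \<bar>a n x\<bar>) \<longlonglongrightarrow> 0" for N
  proof -
    have "(\<lambda>n. \<Sum>x\<in>G N. \<bar>\<Sum>y\<in>{x} \<inter> F n. a n y\<bar>) \<longlonglongrightarrow> (\<Sum>x\<in>G N. 0)"
      by (intro tendsto_sum tendsto_rabs_zero null) (auto simp: G_def)
    moreover have "(\<Sum>x\<in>G N. \<bar>\<Sum>y\<in>{x} \<inter> F n. a n y\<bar>) = (\<Sum>x\<in>G N \<inter> F n. \<bar>a n x\<bar>)" for n
      unfolding sum.inter_restrict[OF finG] by (intro sum.cong) auto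
    ultimately show ?thesis by simp
  qed
  have "\<exists>n>N. (\<Sum>x\<in>G N \<inter> F n. \<bar>a n x\<bar>) < e / 8" for N
  proof -
    have "\<forall>\<^sub>F n in sequentially. (\<Sum>x\<in>G N \<inter> F n. \<bar>a n x\<bar>) < e / 8"
      using \<open>e > 0\<close> by (intro order_tendstoD(2)[OF G_null]) simp
    then have "\<forall>\<^sub>F n in sequentially. n > N \<and> (\<Sum>x\<in>G N \<inter> F n. \<bar>a n x\<bar>) < e / 8"
      by (intro eventually_conj eventually_gt_at_top)
    then show ?thesis
      unfolding eventually_sequentially by blast
  qed
  then obtain nxt where nxt: "\<And>N. nxt N > N"
      "\<And>N. (\<Sum>x\<in>G N \<inter> F (nxt N). \<bar>a (nxt N) x\<bar>) < e / 8"
    by metis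
  define r where "r k = (nxt ^^ k) 0" for k
  have r_Suc: "r (Suc k) = nxt (r k)" for k
    by (simp add: r_def)
  have r_mono: "strict_mono r"
    by (intro strict_monoI_Suc) (simp add: r_Suc nxt)
  have "\<exists>P \<subseteq> F (r (Suc k)) - G (r k).
      (\<Sum>x\<in>F (r (Suc k)) - G (r k). \<bar>a (r (Suc k)) x\<bar>) \<le> 2 * \<bar>\<Sum>x\<in>P. a (r (Suc k)) x\<bar>" for k
    using fin by (intro ex_subset_half_abs_sum) auto
  then obtain P where P_sub: "\<And>k. P k \<subseteq> F (r (Suc k)) - G (r k)"
    and P_half: "\<And>k. (\<Sum>x\<in>F (r (Suc k)) - G (r k). \<bar>a (r (Suc k)) x\<bar>)
      \<le> 2 * \<bar>\<Sum>x\<in>P k. a (r (Suc k)) x\<bar>"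
    by metis
  define B where "B = (\<Union>k. P k)"
  \<comment> \<open>The mass off \<open>G\<close> exceeds \<open>7e/8\<close>, so the hump contributes more than \<open>7e/16\<close> in absolute value
    and the terms in \<open>G\<close> take away less than \<open>e/8\<close>.\<close>
  have B_large: "\<bar>\<Sum>x\<in>B \<inter> F (r (Suc k)). a (r (Suc k)) x\<bar> \<ge> e / 4" for k
  proof -
    let ?n = "r (Suc k)" and ?G = "G (r k)"
    have F_sub: "F (r (Suc j)) \<subseteq> G (r i)" if "j < i" for i j
      using strict_mono_leD[OF r_mono, of "Suc j" i] that by (auto simp: G_def)
    have disj: "P i \<inter> F (r (Suc j)) = {}" if "j < i" for i j
      using P_sub[of i] F_sub[OF that] by blast
    have low: "P i \<subseteq> ?G" if "i < k" for i
      using P_sub[of i] F_sub[OF that] by blast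
    have "x \<in> P k" if "x \<in> B" "x \<in> F ?n" "x \<notin> ?G" for x
    proof -
      obtain i where "x \<in> P i" using \<open>x \<in> B\<close> unfolding B_def by blast
      with that disj[of k i] low[of i] show ?thesis
        by (cases i k rule: linorder_cases) auto
    qed
    then have split: "B \<inter> F ?n = P k \<union> (B \<inter> F ?n \<inter> ?G)"
      using P_sub[of k] by (auto simp: B_def)
    have "finite (P k)"
      using P_sub[of k] fin[of ?n] by (meson finite_Diff finite_subset)
    then have eq: "(\<Sum>x\<in>B \<inter> F ?n. a ?n x) = (\<Sum>x\<in>P k. a ?n x) + (\<Sum>x\<in>B \<inter> F ?n \<inter> ?G. a ?n x)"
      using P_sub[of k] fin by (subst split, intro sum.union_disjoint) auto
    have "\<bar>\<Sum>x\<in>B \<inter> F ?n \<inter> ?G. a ?n x\<bar> \<le> (\<Sum>x\<in>B \<inter> F ?n \<inter> ?G. \<bar>a ?n x\<bar>)"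
      by (rule sum_abs)
    also have "\<dots> \<le> (\<Sum>x\<in>?G \<inter> F ?n. \<bar>a ?n x\<bar>)"
      using fin by (intro sum_mono2) auto
    finally have rest: "\<bar>\<Sum>x\<in>B \<inter> F ?n \<inter> ?G. a ?n x\<bar> < e / 8"
      using nxt(2)[of "r k"] unfolding r_Suc by linarith
    have "(\<Sum>x\<in>F ?n. \<bar>a ?n x\<bar>) = (\<Sum>x\<in>F ?n \<inter> ?G. \<bar>a ?n x\<bar>) + (\<Sum>x\<in>F ?n - ?G. \<bar>a ?n x\<bar>)"
      using fin by (rule sum.Int_Diff)
    then have "2 * \<bar>\<Sum>x\<in>P k. a ?n x\<bar> \<ge> e - e / 8"
      using mass[of ?n] P_half[of k] nxt(2)[of "r k"] unfolding r_Suc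
      by (simp add: Int_commute)
    with eq rest show ?thesis by linarith
  qed
  have "B \<subseteq> (\<Union>n. F n)"
    using P_sub by (fastforce simp: B_def)
  then have "(\<lambda>k. \<Sum>x\<in>B \<inter> F (r (Suc k)). a (r (Suc k)) x) \<longlonglongrightarrow> 0"
    using LIMSEQ_Suc[OF LIMSEQ_subseq_LIMSEQ[OF null r_mono]] by (simp add: o_def)
  then have "\<forall>\<^sub>F k in sequentially. \<bar>\<Sum>x\<in>B \<inter> F (r (Suc k)). a (r (Suc k)) x\<bar> < e / 4"
    using \<open>e > 0\<close> by (intro order_tendstoD(2)[OF tendsto_rabs_zero]) auto
  then show False
    using B_large by (auto simp: not_less[symmetric])
qed

section \<open>Finitely supported Radon measures as sums of point masses\<close>

lemma openin_borel_of: "openin K U \<Longrightarrow> U \<in> sets (borel_of K)"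
  unfolding borel_of_def by (subst sets_measure_of) (auto dest: openin_subset)

lemma closedin_borel_of: "closedin K C \<Longrightarrow> C \<in> sets (borel_of K)"
  using sets.Diff[OF sets.top openin_borel_of, of K "topspace K - C"]
  by (simp add: closedin_def double_diff)

lemma countable_borel_of:
  assumes "Hausdorff_space K" "countable A" "A \<subseteq> topspace K"
  shows "A \<in> sets (borel_of K)"
proof (rule sets.countable)
  show "{x} \<in> sets (borel_of K)" if "x \<in> A" for x
    using assms that by (intro closedin_borel_of closedin_Hausdorff_singleton) auto
qed fact

lemma abs_le_variation:
  assumes "E \<in> sets (borel_of K)" "B \<in> sets (borel_of K)" "E \<subseteq> B"
  shows "ennreal \<bar>\<mu> E\<bar> \<le> variation K \<mu> B"
proof -
  have "ennreal \<bar>\<mu> E\<bar> \<le> (\<Sum>E\<in>{E, B - E}. ennreal \<bar>\<mu> E\<bar>)"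
    by (rule member_le_sum) auto
  also have "\<dots> \<le> variation K \<mu> B"
    unfolding variation_def using assms
    by (intro SUP_upper) (auto simp: disjoint_def)
  finally show ?thesis .
qed

text \<open>
  The hypothesis on the members of \<open>\<U>\<close> amounts to their having variation zero. Stated through
  Borel subsets, it lets additivity remove one member of the cover at a time.
\<close>

lemma signed_measure_finite_cover_zero:
  assumes "signed_measure K \<mu>" "finite \<U>" "\<U> \<subseteq> sets (borel_of K)"
    and "\<forall>U\<in>\<U>. \<forall>E\<in>sets (borel_of K). E \<subseteq> U \<longrightarrow> \<mu> E = 0"
    and "E \<in> sets (borel_of K)" "E \<subseteq> \<Union>\<U>"
  shows "\<mu> E = 0"
  using assms(2-)
proof (induction \<U> arbitrary: E rule: finite_induct)
  case empty
  then show ?case using assms(1) by (simp add: signed_measure_def)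
next
  case (insert U \<U>)
  have EU: "E \<inter> U \<in> sets (borel_of K)" "E - U \<in> sets (borel_of K)"
    using insert.prems(1,3) by auto
  have "\<mu> ((E \<inter> U) \<union> (E - U)) = \<mu> (E \<inter> U) + \<mu> (E - U)"
    by (rule signed_measure_Un[OF assms(1) EU]) auto
  moreover have "\<mu> (E \<inter> U) = 0"
    using insert.prems(2) EU(1) by simp
  moreover have "\<mu> (E - U) = 0"
    using insert.prems(1,2,4) EU(2) by (intro insert.IH) auto
  moreover have "(E \<inter> U) \<union> (E - U) = E"
    by auto
  ultimately show ?case by simp
qed

text \<open>
  By compactness, a compact set that misses the support is covered by finitely many open sets of
  variation zero; inner regularity carries this over to all Borel sets.
\<close>

lemma radon_measure_zero_off_support:
  assumes "radon_measure K \<mu>" "Hausdorff_space K" "B \<in> sets (borel_of K)"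
    and "B \<inter> measure_support K \<mu> = {}"
  shows "\<mu> B = 0"
proof -
  have sm: "signed_measure K \<mu>" using assms(1) by (simp add: radon_measure_def)
  have B_sub: "B \<subseteq> topspace K"
    using sets.sets_into_space[OF assms(3)] by simp
  have zero: "\<mu> C = 0" if C: "compactin K C" "C \<subseteq> B" for C
  proof -
    let ?\<U> = "{U. openin K U \<and> variation K \<mu> U = 0}"
    have "C \<subseteq> \<Union>?\<U>"
    proof
      fix x assume "x \<in> C"
      then have "x \<in> topspace K" "x \<notin> measure_support K \<mu>"
        using C assms(4) B_sub by auto
      then show "x \<in> \<Union>?\<U>" by (auto simp: measure_support_def)
    qed
    then obtain \<V> where \<V>: "finite \<V>" "\<V> \<subseteq> ?\<U>" "C \<subseteq> \<Union>\<V>"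
      using compactinD[OF C(1), of ?\<U>] by auto
    show ?thesis
    proof (rule signed_measure_finite_cover_zero[OF sm \<V>(1) _ _ _ \<V>(3)])
      show "\<V> \<subseteq> sets (borel_of K)" using \<V> openin_borel_of by blast
      show "C \<in> sets (borel_of K)"
        using C assms(2) by (intro closedin_borel_of compactin_imp_closedin)
      have "\<mu> E = 0" if "U \<in> \<V>" "E \<in> sets (borel_of K)" "E \<subseteq> U" for U E
      proof -
        have "openin K U" "variation K \<mu> U = 0" using that \<V>(2) by auto
        then have "ennreal \<bar>\<mu> E\<bar> \<le> 0"
          using abs_le_variation[of E K U \<mu>] openin_borel_of[of K U] that by simp
        then show ?thesis by (simp add: ennreal_eq_0_iff)
      qed
      then show "\<forall>U\<in>\<V>. \<forall>E\<in>sets (borel_of K). E \<subseteq> U \<longrightarrow> \<mu> E = 0" by blast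
    qed
  qed
  have "\<bar>\<mu> B\<bar> \<le> 0 + e" if "e > 0" for e
  proof -
    obtain C where C: "compactin K C" "C \<subseteq> B" "variation K \<mu> (B - C) < ennreal e"
      using assms(1,3) \<open>e > 0\<close> unfolding radon_measure_def by blast
    have CB: "C \<in> sets (borel_of K)"
      using C assms(2) by (intro closedin_borel_of compactin_imp_closedin)
    have "\<mu> (C \<union> (B - C)) = \<mu> C + \<mu> (B - C)"
      using CB assms(3) by (intro signed_measure_Un[OF sm]) auto
    also have "C \<union> (B - C) = B" using C(2) by auto
    finally have "\<mu> B = \<mu> (B - C)" using zero[OF C(1,2)] by simp
    moreover have "ennreal \<bar>\<mu> (B - C)\<bar> < ennreal e"
      using abs_le_variation[of "B - C" K "B - C" \<mu>] CB assms(3) C(3)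
      by (auto intro: le_less_trans)
    ultimately show ?thesis by (simp add: ennreal_less_iff)
  qed
  then have "\<bar>\<mu> B\<bar> \<le> 0" by (rule field_le_epsilon)
  then show ?thesis by simp
qed

lemma signed_measure_finite_set:
  assumes "signed_measure K \<mu>" "Hausdorff_space K" "finite A" "A \<subseteq> topspace K"
  shows "\<mu> A = (\<Sum>x\<in>A. \<mu> {x})"
  using assms(3,4)
proof (induction A rule: finite_induct)
  case empty
  then show ?case using assms(1) by (simp add: signed_measure_def)
next
  case (insert x A)
  have "A \<in> sets (borel_of K)" "{x} \<in> sets (borel_of K)"
    using insert.hyps(1) insert.prems by (auto intro!: countable_borel_of[OF assms(2)] countable_finite)
  then have "\<mu> ({x} \<union> A) = \<mu> {x} + \<mu> A"
    using insert.hyps(2) by (intro signed_measure_Un[OF assms(1)]) auto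
  also have "\<mu> A = (\<Sum>y\<in>A. \<mu> {y})"
    using insert.prems by (intro insert.IH) auto
  also have "\<mu> {x} + \<dots> = (\<Sum>y\<in>insert x A. \<mu> {y})"
    using insert.hyps by simp
  finally show ?case by simp
qed

lemma radon_measure_eq_sum_point_masses:
  assumes "radon_measure K \<mu>" "Hausdorff_space K" "finite (measure_support K \<mu>)"
    and B: "B \<in> sets (borel_of K)"
  shows "\<mu> B = (\<Sum>x\<in>B \<inter> measure_support K \<mu>. \<mu> {x})"
proof -
  let ?F = "measure_support K \<mu>"
  have sm: "signed_measure K \<mu>" using assms(1) by (simp add: radon_measure_def)
  have F_sub: "?F \<subseteq> topspace K" by (auto simp: measure_support_def)
  have F: "?F \<in> sets (borel_of K)"
    by (rule countable_borel_of[OF assms(2) countable_finite[OF assms(3)] F_sub])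
  have "\<mu> ((B - ?F) \<union> (B \<inter> ?F)) = \<mu> (B - ?F) + \<mu> (B \<inter> ?F)"
    using B F by (intro signed_measure_Un[OF sm]) auto
  also have "\<mu> (B - ?F) = 0"
    by (rule radon_measure_zero_off_support[OF assms(1,2) sets.Diff[OF B F]]) auto
  also have "\<mu> (B \<inter> ?F) = (\<Sum>x\<in>B \<inter> ?F. \<mu> {x})"
    using assms(3) F_sub by (intro signed_measure_finite_set[OF sm assms(2)]) auto
  finally show ?thesis by (simp add: Un_Diff_Int)
qed

lemma total_variation_norm_le_sum_point_masses:
  assumes "radon_measure K \<mu>" "Hausdorff_space K" "finite (measure_support K \<mu>)"
  shows "total_variation_norm K \<mu> \<le> ennreal (\<Sum>x\<in>measure_support K \<mu>. \<bar>\<mu> {x}\<bar>)"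
  unfolding total_variation_norm_def variation_def
proof (rule SUP_least)
  let ?F = "measure_support K \<mu>"
  fix P assume "P \<in> {P. finite P \<and> disjoint P \<and> P \<subseteq> sets (borel_of K) \<and> \<Union>P = topspace K}"
  then have P: "finite P" "disjoint P" "P \<subseteq> sets (borel_of K)" by auto
  have "(\<Sum>E\<in>P. \<bar>\<mu> E\<bar>) \<le> (\<Sum>E\<in>P. \<Sum>x\<in>E \<inter> ?F. \<bar>\<mu> {x}\<bar>)"
  proof (rule sum_mono)
    fix E assume "E \<in> P"
    then have "\<mu> E = (\<Sum>x\<in>E \<inter> ?F. \<mu> {x})"
      using P by (intro radon_measure_eq_sum_point_masses[OF assms]) auto
    then show "\<bar>\<mu> E\<bar> \<le> (\<Sum>x\<in>E \<inter> ?F. \<bar>\<mu> {x}\<bar>)"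
      using sum_abs by metis
  qed
  also have "\<dots> = (\<Sum>x\<in>(\<Union>E\<in>P. E \<inter> ?F). \<bar>\<mu> {x}\<bar>)"
    using P assms(3) by (intro sum.UNION_disjoint[symmetric]) (auto simp: disjoint_def)
  also have "\<dots> \<le> (\<Sum>x\<in>?F. \<bar>\<mu> {x}\<bar>)"
    using assms(3) by (intro sum_mono2) auto
  finally show "(\<Sum>E\<in>P. ennreal \<bar>\<mu> E\<bar>) \<le> ennreal (\<Sum>x\<in>?F. \<bar>\<mu> {x}\<bar>)"
    by (simp add: sum_ennreal ennreal_leI)
qed

lemma variation_zero: "variation K (\<lambda>_. 0) B = 0"
proof -
  have "variation K (\<lambda>_. 0) B \<le> 0"
    unfolding variation_def by (rule SUP_least) simp
  then show ?thesis by simp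
qed

lemma radon_measure_zero: "radon_measure K (\<lambda>_. 0)"
proof -
  have "\<exists>C. compactin K C \<and> C \<subseteq> B \<and> variation K (\<lambda>_. 0) (B - C) < ennreal e" if "e > 0" for B e
    using that by (intro exI[of _ "{}"]) (simp add: variation_zero)
  then show ?thesis
    by (simp add: radon_measure_def signed_measure_def)
qed

section \<open>The Grothendieck property excludes fsJNP\<close>

theorem corollary6p6:
  fixes K :: "'a topology"
  assumes "compact_space K" and "Hausdorff_space K"
    and "grothendieck_property K"
  shows "\<not> fsJNP K"
proof
  assume "fsJNP K"
  then obtain \<mu> where radon: "\<And>n. radon_measure K (\<mu> n)"
    and fin: "\<And>n. finite (measure_support K (\<mu> n))"
    and norm: "\<And>n. total_variation_norm K (\<mu> n) = 1"
    and "weakly_star_convergent K \<mu> (\<lambda>_. 0)"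
    unfolding fsJNP_def by blast
  then have weak: "weakly_convergent K \<mu> (\<lambda>_. 0)"
    using assms(3) radon_measure_zero unfolding grothendieck_property_def by blast
  let ?F = "\<lambda>n. measure_support K (\<mu> n)"
  have "1 \<le> (\<Sum>x\<in>?F n. \<bar>\<mu> n {x}\<bar>)" for n
    using total_variation_norm_le_sum_point_masses[OF radon assms(2) fin, of n] norm[of n]
    by simp
  then obtain B where B: "B \<subseteq> (\<Union>n. ?F n)"
      "\<not> (\<lambda>n. \<Sum>x\<in>B \<inter> ?F n. \<mu> n {x}) \<longlonglongrightarrow> 0"
    using gliding_hump[of ?F 1 "\<lambda>n x. \<mu> n {x}"] fin by auto
  have "countable (\<Union>n. ?F n)"
    using fin by (simp add: countable_finite)
  then have "countable B"
    using B(1) countable_subset by blast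
  then have B_borel: "B \<in> sets (borel_of K)"
    using B(1) by (intro countable_borel_of assms(2)) (auto simp: measure_support_def)
  then have "(\<lambda>n. \<mu> n B) \<longlonglongrightarrow> 0"
    using weak by (simp add: weakly_convergent_def)
  with B(2) show False
    using radon_measure_eq_sum_point_masses[OF radon assms(2) fin B_borel] by simp
qed

end
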